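(* Let $\alpha$ be an integer with $\alpha=2$ or $\alpha\ge 4$, and let $m$ be an odd positive integer. Then $$I(2^\alpha m+1)\ \ge\ 2^\alpha m\left[\frac{2^\alpha m\,(3m\,2^\alpha+2^\alpha-20)}{16}+m+1\right]+2^{\alpha-1}m(m-1).$$
   Context: A Latin square of order $n$ is an $n\times n$ array with entries from a set of $n$ symbols such that each symbol occurs exactly once in each row and exactly once in each column; it is identified with the set of triples $(i,j;k)$ meaning that symbol $k$ occurs in row $i$, column $j$. An intercalate in a Latin square $L$ is a $2\times 2$ subsquare of $L$, i.e. a set of four entries $\{(r_1,c_1;e_1),(r_1,c_2;e_2),(r_2,c_1;e_2),(r_2,c_2;e_1)\}\subseteq L$ with $r_1\ne r_2$, $c_1\ne c_2$, $e_1\neq e_2$. $I(L)$ is the number of intercalates in $L$ (counted as sets of entries), and $I(n)$ is the maximum of $I(L)$ over all Latin squares $L$ of order $n$. *)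

theory Defs
  imports Complex_Main
begin

(* A Latin square is given by its set of triples (row, column, symbol).  Rows, columns and the
   n symbols are all taken to be 0, ..., n - 1; relabelling does not affect intercalate counts. *)

definition latin_square :: "nat \<Rightarrow> (nat \<times> nat \<times> nat) set \<Rightarrow> bool" where
  "latin_square n L \<longleftrightarrow>
     L \<subseteq> {..<n} \<times> {..<n} \<times> {..<n} \<and>
     (\<forall>i<n. \<forall>j<n. \<exists>!k. (i, j, k) \<in> L) \<and>
     (\<forall>i<n. \<forall>k<n. \<exists>!j. (i, j, k) \<in> L) \<and>
     (\<forall>j<n. \<forall>k<n. \<exists>!i. (i, j, k) \<in> L)"

definition intercalates :: "(nat \<times> nat \<times> nat) set \<Rightarrow> (nat \<times> nat \<times> nat) set set" where
  "intercalates L =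
     {Q. Q \<subseteq> L \<and>
         (\<exists>r1 r2 c1 c2 e1 e2. r1 \<noteq> r2 \<and> c1 \<noteq> c2 \<and> e1 \<noteq> e2 \<and>
            Q = {(r1, c1, e1), (r1, c2, e2), (r2, c1, e2), (r2, c2, e1)})}"

definition num_intercalates :: "(nat \<times> nat \<times> nat) set \<Rightarrow> nat" where
  "num_intercalates L = card (intercalates L)"

definition max_intercalates :: "nat \<Rightarrow> nat" where
  "max_intercalates n = Max (num_intercalates ` {L. latin_square n L})"

(* The following facts show that the cardinality and the maximum above are taken over
   finite sets, and the maximum over a nonempty one. *)

lemma finite_latin_square: "latin_square n L \<Longrightarrow> finite L"
  unfolding latin_square_def by (rule finite_subset[of _ "{..<n} \<times> {..<n} \<times> {..<n}"]) auto

lemma finite_intercalates: "latin_square n L \<Longrightarrow> finite (intercalates L)"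
  by (rule finite_subset[of _ "Pow L"]) (auto simp: intercalates_def finite_latin_square)

lemma finite_latin_squares: "finite {L. latin_square n L}"
  by (rule finite_subset[of _ "Pow ({..<n} \<times> {..<n} \<times> {..<n})"]) (auto simp: latin_square_def)

lemma ex1_add_mod:
  fixes n a k :: nat
  assumes "a < n" "k < n"
  shows "\<exists>!j. j < n \<and> k = (a + j) mod n"
proof -
  have mod: "(a + j) mod n = (if a + j < n then a + j else a + j - n)" if "j < n" for j
    using that assms by (simp add: mod_if)
  show ?thesis
  proof (rule ex1I)
    let ?j = "if a \<le> k then k - a else n + k - a"
    have "?j < n"
      using assms by auto
    then show "?j < n \<and> k = (a + ?j) mod n"
      using assms mod[of ?j] by (auto split: if_splits)
  next
    fix j
    assume "j < n \<and> k = (a + j) mod n"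
    then show "j = (if a \<le> k then k - a else n + k - a)"
      using assms mod[of j] by (auto split: if_splits)
  qed
qed

lemma ex_latin_square: "\<exists>L. latin_square n L"
proof
  let ?L = "{(i, j, k). i < n \<and> j < n \<and> k = (i + j) mod n}"
  have "\<exists>!j. (i, j, k) \<in> ?L" if "i < n" "k < n" for i k
    using ex1_add_mod[OF that] that(1) by simp
  moreover have "\<exists>!i. (i, j, k) \<in> ?L" if "j < n" "k < n" for j k
    using ex1_add_mod[OF that] that(1) by (simp add: add.commute)
  moreover have "\<exists>!k. (i, j, k) \<in> ?L" if "i < n" "j < n" for i j
    using that by simp
  moreover have "?L \<subseteq> {..<n} \<times> {..<n} \<times> {..<n}"
    by auto
  ultimately show "latin_square n ?L"
    unfolding latin_square_def by (intro conjI allI impI)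
qed

end

theory Submission
  imports Defs
begin

text \<open>
  Let \<open>q = 2^\<alpha>\<close> and \<open>N = q m\<close>, identify \<open>{0, ..., q - 1}\<close> under \<open>XOR\<close> with \<open>F_2^\<alpha>\<close>, and consider
  the Latin square \<open>(g, x) (h, y) = (g XOR h, \<plusminus>x \<plusminus> y)\<close> on \<open>F_2^\<alpha> \<times> Z_m\<close>, where both signs depend only
  on the lowest two bits of \<open>g\<close> and \<open>h\<close>. The signs are chosen such that, for rows with distinct lowest
  two bits, the two equations in \<open>y, y'\<close> that define an intercalate are equivalent. Hence such a pair
  of rows meets every column in an intercalate, and so does a pair of rows with the same lowest two
  bits and the same \<open>x\<close>. So each row has \<open>D = 3N/4 + q/4 - 1\<close> partner rows.

  An orthomorphism \<open>\<phi>\<close> of \<open>F_2^\<alpha>\<close> yields the transversal with cells \<open>((g, x), (\<phi> g, \<plusminus>x))\<close>; here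
  \<open>m\<close> odd is needed, as the symbols are \<open>\<plusminus>2x\<close>. Prolong the square along it, i.e. move the symbols of
  the transversal to a new row and a new column and put a new symbol in its place. Of the \<open>N\<close>
  columns at most 4 are spoiled for a pair of partner rows. There is one new intercalate
  through the new corner for each of the \<open>N\<close> transversal cells, and two transversal cells with the same
  \<open>g\<close> span an intercalate containing the new symbol twice. Each intercalate comes from 4 ordered
  quadruples of rows and columns, so 4 times the number of intercalates is at least
  \<open>N D (N - 4) + 4 N + 2 q m (m - 1)\<close>. This exceeds 4 times the bound by \<open>4 N (m - 1) (q/4 - 1)\<close>.
\<close>

unbundle bit_operations_syntax

section \<open>Latin squares as operations, and intercalates as ordered quadruples\<close>

definition latin_op :: "'a set \<Rightarrow> ('a \<Rightarrow> 'a \<Rightarrow> 'a) \<Rightarrow> bool" where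
  "latin_op A f \<longleftrightarrow> finite A \<and> (\<forall>r\<in>A. \<forall>c\<in>A. f r c \<in> A) \<and>
     (\<forall>r\<in>A. inj_on (f r) A) \<and> (\<forall>c\<in>A. inj_on (\<lambda>r. f r c) A)"

lemma latin_opI:
  assumes "finite A" "\<And>r c. r \<in> A \<Longrightarrow> c \<in> A \<Longrightarrow> f r c \<in> A"
    and "\<And>r c c'. r \<in> A \<Longrightarrow> c \<in> A \<Longrightarrow> c' \<in> A \<Longrightarrow> f r c = f r c' \<Longrightarrow> c = c'"
    and "\<And>r r' c. r \<in> A \<Longrightarrow> r' \<in> A \<Longrightarrow> c \<in> A \<Longrightarrow> f r c = f r' c \<Longrightarrow> r = r'"
  shows "latin_op A f"
  unfolding latin_op_def
proof (intro conjI ballI inj_onI)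
  show "c = c'" if "r \<in> A" "c \<in> A" "c' \<in> A" "f r c = f r c'" for r c c'
    using assms(3) that by blast
  show "r = r'" if "c \<in> A" "r \<in> A" "r' \<in> A" "f r c = f r' c" for r r' c
    using assms(4) that by blast
qed (use assms(1,2) in blast)+

lemma latin_op_closed: "latin_op A f \<Longrightarrow> r \<in> A \<Longrightarrow> c \<in> A \<Longrightarrow> f r c \<in> A"
  by (simp add: latin_op_def)

lemma latin_op_cancel_left:
  "latin_op A f \<Longrightarrow> r \<in> A \<Longrightarrow> c \<in> A \<Longrightarrow> c' \<in> A \<Longrightarrow> f r c = f r c' \<longleftrightarrow> c = c'"
  unfolding latin_op_def by (metis inj_onD)

lemma latin_op_cancel_right:
  assumes "latin_op A f" "r \<in> A" "r' \<in> A" "c \<in> A"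
  shows "f r c = f r' c \<longleftrightarrow> r = r'"
proof -
  have "inj_on (\<lambda>r. f r c) A"
    using assms by (simp add: latin_op_def)
  then show ?thesis
    using assms by (auto dest: inj_onD)
qed

definition quads :: "'a set \<Rightarrow> ('a \<Rightarrow> 'a \<Rightarrow> 'a) \<Rightarrow> ('a \<times> 'a \<times> 'a \<times> 'a) set" where
  "quads A f = {(r1, r2, c1, c2). r1 \<in> A \<and> r2 \<in> A \<and> c1 \<in> A \<and> c2 \<in> A \<and> r1 \<noteq> r2 \<and> c1 \<noteq> c2 \<and>
     f r1 c1 = f r2 c2 \<and> f r1 c2 = f r2 c1}"

lemma finite_quads: "finite A \<Longrightarrow> finite (quads A f)"
  by (rule finite_subset[of _ "A \<times> A \<times> A \<times> A"]) (auto simp: quads_def)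

lemma ex1_inj_on_self_map:
  assumes "finite A" "inj_on g A" "\<And>x. x \<in> A \<Longrightarrow> g x \<in> A" "y \<in> A"
  shows "\<exists>!x. x \<in> A \<and> g x = y"
proof -
  have "g ` A = A"
    using assms by (intro endo_inj_surj) auto
  then show ?thesis
    using assms by (metis image_iff inj_onD)
qed

lemma card_le_mult_card_image:
  assumes "finite X" "finite Y" "\<And>x. x \<in> X \<Longrightarrow> g x \<in> Y"
    and "\<And>y. card {x \<in> X. g x = y} \<le> k"
  shows "card X \<le> k * card Y"
proof -
  have "X = (\<Union>y\<in>Y. {x \<in> X. g x = y})"
    using assms(3) by auto
  then have "card X \<le> (\<Sum>y\<in>Y. card {x \<in> X. g x = y})"
    using card_UN_le[OF assms(2), of "\<lambda>y. {x \<in> X. g x = y}"] by simp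
  also have "\<dots> \<le> (\<Sum>y\<in>Y. k)"
    by (rule sum_mono) (rule assms(4))
  finally show ?thesis
    by (simp add: mult.commute)
qed

text \<open>Sending a quadruple to its four triples is at most 4-to-1: the triples reveal the pair
  of rows and the pair of columns, so only the order within each pair is lost.\<close>

lemma card_quads_le:
  assumes f: "latin_op {..<n} f"
  shows "card (quads {..<n} f) \<le> 4 * max_intercalates n"
proof -
  define L where "L = {(i, j, k). i < n \<and> j < n \<and> k = f i j}"
  have closed: "f i j < n" if "i < n" "j < n" for i j
    using f that by (auto simp: latin_op_def)
  have injr: "inj_on (f i) {..<n}" if "i < n" for i
    using f that by (auto simp: latin_op_def)
  have injc: "inj_on (\<lambda>i. f i j) {..<n}" if "j < n" for j
    using f that by (auto simp: latin_op_def)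
  have L_iff: "(i, j, k) \<in> L \<longleftrightarrow> i < n \<and> j < n \<and> f i j = k" for i j k
    by (auto simp: L_def)
  have "\<exists>!j. (i, j, k) \<in> L" if "i < n" "k < n" for i k
  proof -
    have "\<exists>!j. j \<in> {..<n} \<and> f i j = k"
      using that injr closed by (intro ex1_inj_on_self_map) auto
    then show ?thesis
      using that by (simp add: L_iff)
  qed
  moreover have "\<exists>!i. (i, j, k) \<in> L" if "j < n" "k < n" for j k
  proof -
    have "\<exists>!i. i \<in> {..<n} \<and> f i j = k"
      using that injc closed by (intro ex1_inj_on_self_map) auto
    then show ?thesis
      using that by (simp add: L_iff)
  qed
  moreover have "\<exists>!k. (i, j, k) \<in> L" if "i < n" "j < n" for i j
    using that by (simp add: L_iff)
  moreover have "L \<subseteq> {..<n} \<times> {..<n} \<times> {..<n}"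
    by (auto simp: L_def closed)
  ultimately have L: "latin_square n L"
    unfolding latin_square_def by (intro conjI allI impI)
  define S where "S = (\<lambda>(r1, r2, c1, c2).
    {(r1, c1, f r1 c1), (r1, c2, f r1 c2), (r2, c1, f r1 c2), (r2, c2, f r1 c1)})"
  have "S t \<in> intercalates L" if t: "t \<in> quads {..<n} f" for t
  proof -
    obtain r1 r2 c1 c2 where t': "t = (r1, r2, c1, c2)"
      by (metis prod_cases4)
    have "f r1 c1 \<noteq> f r1 c2"
      using t injr[of r1] by (auto simp: t' quads_def inj_on_def)
    moreover have "S t \<subseteq> L"
      using t by (auto simp: t' quads_def S_def L_def)
    moreover have "r1 \<noteq> r2" "c1 \<noteq> c2"
      using t by (auto simp: t' quads_def)
    ultimately show ?thesis
      unfolding intercalates_def S_def t' by blast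
  qed
  moreover have "card {t \<in> quads {..<n} f. S t = Q} \<le> 4" for Q
  proof (cases "{t \<in> quads {..<n} f. S t = Q} = {}")
    case False
    then obtain r1 r2 c1 c2 where Q: "S (r1, r2, c1, c2) = Q"
      by auto
    have "{t \<in> quads {..<n} f. S t = Q} \<subseteq>
      {(r1, r2, c1, c2), (r2, r1, c1, c2), (r1, r2, c2, c1), (r2, r1, c2, c1)}"
    proof (rule subsetI)
      fix t
      assume "t \<in> {t \<in> quads {..<n} f. S t = Q}"
      then obtain a b c d where t_eq: "t = (a, b, c, d)" and t: "(a, b, c, d) \<in> quads {..<n} f"
        and *: "S (a, b, c, d) = S (r1, r2, c1, c2)"
        using Q by (cases t) auto
      have "fst ` S (a, b, c, d) = {a, b}" "fst ` S (r1, r2, c1, c2) = {r1, r2}"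
        "(fst \<circ> snd) ` S (a, b, c, d) = {c, d}" "(fst \<circ> snd) ` S (r1, r2, c1, c2) = {c1, c2}"
        by (auto simp: S_def)
      then have "{a, b} = {r1, r2}" "{c, d} = {c1, c2}"
        unfolding * by metis+
      moreover have "a \<noteq> b" "c \<noteq> d"
        using t by (auto simp: quads_def)
      ultimately show "t \<in>
        {(r1, r2, c1, c2), (r2, r1, c1, c2), (r1, r2, c2, c1), (r2, r1, c2, c1)}"
        by (auto simp: t_eq doubleton_eq_iff)
    qed
    then have "card {t \<in> quads {..<n} f. S t = Q} \<le>
      card {(r1, r2, c1, c2), (r2, r1, c1, c2), (r1, r2, c2, c1), (r2, r1, c2, c1)}"
      by (intro card_mono) auto
    also have "\<dots> \<le> 4"
      by (auto intro!: card_insert_le_m1)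
    finally show ?thesis .
  next
    case True
    then show ?thesis
      by (simp only: card.empty)
  qed
  ultimately have "card (quads {..<n} f) \<le> 4 * card (intercalates L)"
    using finite_quads[of "{..<n}" f] finite_intercalates[OF L]
    by (intro card_le_mult_card_image[where g = S]) auto
  moreover have "num_intercalates L \<le> max_intercalates n"
    unfolding max_intercalates_def using L finite_latin_squares by (intro Max_ge) auto
  ultimately show ?thesis
    by (simp add: num_intercalates_def)
qed

text \<open>Relabelling by a bijection \<open>e\<close> preserves quadruples, so the construction
  may use pairs and options as its points.\<close>

lemma card_quads_le_max_intercalates:
  assumes f: "latin_op A f"
  shows "card (quads A f) \<le> 4 * max_intercalates (card A)"
proof -
  have fin: "finite A"
    using f by (simp add: latin_op_def)
  then obtain e where e: "bij_betw e A {..<card A}"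
    using ex_bij_betw_finite_nat by (metis atLeast0LessThan)
  define d where "d = inv_into A e"
  have d: "bij_betw d {..<card A} A"
    using e unfolding d_def by (rule bij_betw_inv_into)
  have ed: "e x < card A" "d (e x) = x" if "x \<in> A" for x
    using e that by (auto simp: d_def bij_betw_def)
  have dA: "d i \<in> A" if "i < card A" for i
    using d that by (auto simp: bij_betw_def)
  have dinj: "d i = d j \<longleftrightarrow> i = j" if "i < card A" "j < card A" for i j
    using d that by (auto simp: bij_betw_def inj_on_def)
  have einj: "e i = e j \<longleftrightarrow> i = j" if "i \<in> A" "j \<in> A" for i j
    using e that by (auto simp: bij_betw_def inj_on_def)
  define h where "h i j = e (f (d i) (d j))" for i j
  note closed = latin_op_closed[OF f]
  have h: "latin_op {..<card A} h"
  proof (rule latin_opI)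
    show "c = c'" if "r \<in> {..<card A}" "c \<in> {..<card A}" "c' \<in> {..<card A}" "h r c = h r c'" for r c c'
      using that latin_op_cancel_left[OF f, of "d r" "d c" "d c'"] by (simp add: h_def einj closed dA dinj)
    show "r = r'" if "r \<in> {..<card A}" "r' \<in> {..<card A}" "c \<in> {..<card A}" "h r c = h r' c" for r r' c
      using that latin_op_cancel_right[OF f, of "d r" "d r'" "d c"] by (simp add: h_def einj closed dA dinj)
  qed (simp_all add: h_def ed closed dA)
  define E where "E = (\<lambda>(r1, r2, c1, c2). (e r1, e r2, e c1, e c2))"
  have "inj_on E (quads A f)"
    by (auto simp: inj_on_def E_def quads_def einj)
  moreover have "E ` quads A f \<subseteq> quads {..<card A} h"
    by (auto simp: E_def quads_def h_def ed einj closed)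
  ultimately have "card (quads A f) \<le> card (quads {..<card A} h)"
    by (intro card_inj_on_le finite_quads) auto
  also have "\<dots> \<le> 4 * max_intercalates (card A)"
    by (rule card_quads_le[OF h])
  finally show ?thesis .
qed

section \<open>Prolongation of a Latin square along a transversal\<close>

text \<open>\<open>None\<close> stands for the new row, the new column and the new symbol alike;
  \<open>inv_into A \<theta> c\<close> is the row whose transversal cell lies in column
  \<open>c\<close>.\<close>

fun prolong :: "'a set \<Rightarrow> ('a \<Rightarrow> 'a \<Rightarrow> 'a) \<Rightarrow> ('a \<Rightarrow> 'a) \<Rightarrow> 'a option \<Rightarrow> 'a option \<Rightarrow> 'a option" where
  "prolong A f \<theta> (Some r) (Some c) = (if c = \<theta> r then None else Some (f r c))"
| "prolong A f \<theta> (Some r) None = Some (f r (\<theta> r))"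
| "prolong A f \<theta> None (Some c) = Some (f (inv_into A \<theta> c) c)"
| "prolong A f \<theta> None None = None"

text \<open>Each old row and column trades its transversal symbol for the new one. By
  \<open>\<theta>\<close> each column has exactly one transversal cell, and by
  \<open>\<sigma>\<close> their symbols are distinct, so the traded symbols fill the new row and
  column without repetition.\<close>

lemma latin_op_prolong:
  assumes f: "latin_op A f" and \<theta>: "bij_betw \<theta> A A" and \<sigma>: "inj_on (\<lambda>r. f r (\<theta> r)) A"
  shows "latin_op (insert None (Some ` A)) (prolong A f \<theta>)"
proof -
  have inv: "inv_into A \<theta> c \<in> A" "\<theta> (inv_into A \<theta> c) = c" if "c \<in> A" for c
    using \<theta> that by (auto simp: bij_betw_def inv_into_into f_inv_into_f)
  have inv': "inv_into A \<theta> (\<theta> r) = r" "\<theta> r \<in> A" if "r \<in> A" for r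
    using \<theta> that by (auto simp: bij_betw_def)
  have fin: "finite A"
    using f by (simp add: latin_op_def)
  note closed = latin_op_closed[OF f]
  note cancel = latin_op_cancel_left[OF f] latin_op_cancel_right[OF f]
  have inj\<sigma>: "c = c'" if "f (inv_into A \<theta> c) c = f (inv_into A \<theta> c') c'" "c \<in> A" "c' \<in> A" for c c'
    using inj_onD[OF \<sigma>, of "inv_into A \<theta> c" "inv_into A \<theta> c'"] inv that by metis
  have inj\<theta>: "r = r'" if "\<theta> r = \<theta> r'" "r \<in> A" "r' \<in> A" for r r'
    using inv' that by metis
  have inv_eq: "r = inv_into A \<theta> c \<longleftrightarrow> c = \<theta> r" if "r \<in> A" "c \<in> A" for r c
    using inv inv' that by metis
  show ?thesis
  proof (rule latin_opI)
    show "finite (insert None (Some ` A))"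
      using fin by simp
    show "prolong A f \<theta> r c \<in> insert None (Some ` A)"
      if "r \<in> insert None (Some ` A)" "c \<in> insert None (Some ` A)" for r c
      using that by (cases r; cases c) (auto simp: closed inv inv' split: if_splits)
    show "c = c'" if r: "r \<in> insert None (Some ` A)" and c: "c \<in> insert None (Some ` A)"
      and c': "c' \<in> insert None (Some ` A)" and eq: "prolong A f \<theta> r c = prolong A f \<theta> r c'" for r c c'
    proof (cases r)
      case None
      then show ?thesis
        using eq c c' by (cases c; cases c') (auto dest: inj\<sigma>)
    next
      case (Some a)
      then show ?thesis
        using eq r c c' by (cases c; cases c') (auto simp: cancel inv' split: if_splits)
    qed
    show "r = r'" if r: "r \<in> insert None (Some ` A)" and r': "r' \<in> insert None (Some ` A)"
      and c: "c \<in> insert None (Some ` A)" and eq: "prolong A f \<theta> r c = prolong A f \<theta> r' c" for r r' c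
    proof (cases c)
      case None
      then show ?thesis
        using eq r r' by (cases r; cases r') (auto dest: inj_onD[OF \<sigma>])
    next
      \<comment> \<open>In column \<open>b\<close> the new row holds the symbol that row
        \<open>inv_into A \<theta> b\<close> had there. By cancellation only that old row could
        clash with it, and its cell now holds \<open>None\<close>.\<close>
      case (Some b)
      then show ?thesis
        using eq r r' c
        by (cases r; cases r')
          (auto simp: cancel inv inv' inv_eq inv_eq[THEN trans[OF eq_commute]] split: if_splits dest: inj\<theta>)
    qed
  qed
qed

lemma card_prolong_intercalates_ge:
  assumes f: "latin_op A f" and \<theta>: "bij_betw \<theta> A A" and \<sigma>: "inj_on (\<lambda>r. f r (\<theta> r)) A"
    and R: "\<And>r. r \<in> A \<Longrightarrow> R r \<subseteq> A - {r} \<and> card (R r) = D"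
    and swap: "\<And>r r' c. r \<in> A \<Longrightarrow> r' \<in> R r \<Longrightarrow> c \<in> A \<Longrightarrow> \<exists>c'\<in>A. f r c = f r' c' \<and> f r c' = f r' c"
    and P: "P \<subseteq> {(r, r'). r \<in> A \<and> r' \<in> A \<and> r \<noteq> r' \<and> f r (\<theta> r') = f r' (\<theta> r)}"
  shows "card A * D * (card A - 4) + 4 * card A + 2 * card P \<le> 4 * max_intercalates (card A + 1)"
proof -
  let ?B = "insert None (Some ` A)" and ?h = "prolong A f \<theta>"
  let ?Q = "quads ?B ?h"
  have fin: "finite A"
    using f by (simp add: latin_op_def)
  note cancel = latin_op_cancel_left[OF f] latin_op_cancel_right[OF f]
  have \<theta>A: "\<theta> r \<in> A" "inv_into A \<theta> (\<theta> r) = r" if "r \<in> A" for r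
    using \<theta> that by (auto simp: bij_betw_def)
  have \<theta>inj: "\<theta> r = \<theta> r' \<longleftrightarrow> r = r'" if "r \<in> A" "r' \<in> A" for r r'
    using \<theta>A that by metis
  have cardB: "card ?B = card A + 1"
    using fin by (simp add: card_image)
  obtain sw where sw: "\<And>r r' c. r \<in> A \<Longrightarrow> r' \<in> R r \<Longrightarrow> c \<in> A \<Longrightarrow>
      sw r r' c \<in> A \<and> f r c = f r' (sw r r' c) \<and> f r (sw r r' c) = f r' c"
    using swap by metis
  have sw_sw: "sw r r' (sw r r' c) = c" if "r \<in> A" "r' \<in> R r" "c \<in> A" for r r' c
    using sw[OF that] sw[OF that(1,2), of "sw r r' c"] R[of r] that cancel(1)[of r'] by (metis DiffD1 subsetD)
  \<comment> \<open>A column \<open>c\<close> is spoiled if \<open>c\<close> or its partner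
    \<open>sw r r' c\<close> meets the transversal in row \<open>r\<close> or \<open>r'\<close>. As
    \<open>sw r r'\<close> is an involution, these are the four columns removed.\<close>
  define C where "C r r' = A - {\<theta> r, \<theta> r', sw r r' (\<theta> r), sw r r' (\<theta> r')}" for r r'
  have cardC: "card A - 4 \<le> card (C r r')" for r r'
  proof -
    have "card A - card {\<theta> r, \<theta> r', sw r r' (\<theta> r), sw r r' (\<theta> r')} \<le> card (C r r')"
      unfolding C_def by (rule diff_card_le_card_Diff) auto
    moreover have "card {\<theta> r, \<theta> r', sw r r' (\<theta> r), sw r r' (\<theta> r')} \<le> 4"
      by (auto intro!: card_insert_le_m1)
    ultimately show ?thesis
      by linarith
  qed
  define T where "T = (SIGMA r:A. SIGMA r':R r. C r r')"
  define F where "F = (\<lambda>(r, r', c). (Some r, Some r', Some c, Some (sw r r' c)))"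
  have finR: "finite (R r)" if "r \<in> A" for r
    using R[OF that] fin finite_subset by blast
  have finC: "finite (C r r')" for r r'
    using fin by (simp add: C_def)
  have "card T = (\<Sum>r\<in>A. \<Sum>r'\<in>R r. card (C r r'))"
    unfolding T_def using fin finR finC by (simp add: card_SigmaI)
  also have "\<dots> \<ge> (\<Sum>r\<in>A. \<Sum>r'\<in>R r. card A - 4)"
    by (intro sum_mono cardC)
  also have "(\<Sum>r\<in>A. \<Sum>r'\<in>R r. card A - 4) = card A * D * (card A - 4)"
    using R by simp
  finally have "card A * D * (card A - 4) \<le> card T" .
  moreover have "card (F ` T) = card T"
    by (rule card_image) (auto simp: F_def inj_on_def)
  ultimately have cardF: "card A * D * (card A - 4) \<le> card (F ` T)"
    by simp
  have FQ: "F ` T \<subseteq> ?Q"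
  proof
    fix t
    assume "t \<in> F ` T"
    then obtain r r' c where t: "t = (Some r, Some r', Some c, Some (sw r r' c))"
      and r: "r \<in> A" and r': "r' \<in> R r" and c: "c \<in> A"
      and ne: "c \<noteq> \<theta> r" "c \<noteq> \<theta> r'" "c \<noteq> sw r r' (\<theta> r)" "c \<noteq> sw r r' (\<theta> r')"
      by (auto simp: F_def T_def C_def)
    have r'': "r' \<in> A" "r' \<noteq> r"
      using R[OF r] r' by auto
    have "sw r r' c \<noteq> \<theta> r" "sw r r' c \<noteq> \<theta> r'"
      using sw_sw[OF r r' c] ne by auto
    moreover have "sw r r' c \<noteq> c"
      using sw[OF r r' c] cancel(2)[of r r' c] r r'' c by auto
    ultimately show "t \<in> ?Q"
      using sw[OF r r' c] r r'' c ne by (auto simp: t quads_def)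
  qed
  \<comment> \<open>The corner and the cell \<open>(r, \<theta> r)\<close> hold \<open>None\<close>;
    the other two cells hold \<open>f r (\<theta> r)\<close>. Two orders of rows and two of columns
    give the factor 4.\<close>
  define Z where "Z = (\<lambda>r. (None, Some r, None, Some (\<theta> r))) ` A \<union>
    (\<lambda>r. (Some r, None, None, Some (\<theta> r))) ` A \<union>
    (\<lambda>r. (None, Some r, Some (\<theta> r), None)) ` A \<union>
    (\<lambda>r. (Some r, None, Some (\<theta> r), None)) ` A"
  have cardZ: "card Z = 4 * card A"
    unfolding Z_def using fin by (subst card_Un_disjoint | force simp: card_image inj_on_def)+
  have ZQ: "Z \<subseteq> ?Q"
    by (auto simp: Z_def quads_def \<theta>A)
  have finP: "finite P"
    by (rule finite_subset[OF P]) (rule finite_subset[of _ "A \<times> A"], use fin in auto)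
  \<comment> \<open>Pairs in \<open>P\<close> already fix the order of the rows, so only the two
    orders of the columns are added.\<close>
  define Y where "Y = (\<lambda>(r, r'). (Some r, Some r', Some (\<theta> r), Some (\<theta> r'))) ` P \<union>
    (\<lambda>(r, r'). (Some r, Some r', Some (\<theta> r'), Some (\<theta> r))) ` P"
  have cardY: "card Y = 2 * card P"
    unfolding Y_def
  proof (subst card_Un_disjoint)
    show "(\<lambda>(r, r'). (Some r, Some r', Some (\<theta> r), Some (\<theta> r'))) ` P \<inter>
      (\<lambda>(r, r'). (Some r, Some r', Some (\<theta> r'), Some (\<theta> r))) ` P = {}"
      using P by (auto simp: \<theta>inj)
    have "inj_on (\<lambda>(r, r'). (Some r, Some r', Some (\<theta> r), Some (\<theta> r'))) P"
      "inj_on (\<lambda>(r, r'). (Some r, Some r', Some (\<theta> r'), Some (\<theta> r))) P"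
      by (auto simp: inj_on_def)
    then show "card ((\<lambda>(r, r'). (Some r, Some r', Some (\<theta> r), Some (\<theta> r'))) ` P) +
      card ((\<lambda>(r, r'). (Some r, Some r', Some (\<theta> r'), Some (\<theta> r))) ` P) = 2 * card P"
      by (simp add: card_image)
  qed (use finP in auto)
  have YQ: "Y \<subseteq> ?Q"
    using P by (auto simp: Y_def quads_def \<theta>A \<theta>inj)
  have fins: "finite Z" "finite Y" "finite (F ` T)"
    using FQ ZQ YQ finite_quads[of ?B ?h] fin by (auto intro: finite_subset)
  \<comment> \<open>The first column of a quadruple in \<open>Y\<close> is \<open>\<theta> r\<close>
    or \<open>\<theta> r'\<close>, and \<open>C r r'\<close> excludes both; \<open>None\<close>
    occurs in \<open>Z\<close> only.\<close>
  have "F ` T \<inter> Y = {}"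
    by (auto simp: F_def T_def C_def Y_def)
  moreover have "(F ` T \<union> Y) \<inter> Z = {}"
    by (auto simp: F_def Y_def Z_def)
  ultimately have "card (F ` T) + card Y + card Z = card (F ` T \<union> Y \<union> Z)"
    using fins by (simp add: card_Un_disjoint)
  also have "\<dots> \<le> card ?Q"
    using FQ ZQ YQ fin by (intro card_mono finite_quads) auto
  also have "\<dots> \<le> 4 * max_intercalates (card A + 1)"
    using card_quads_le_max_intercalates[OF latin_op_prolong[OF f \<theta> \<sigma>]] by (simp only: cardB)
  finally show ?thesis
    using cardF cardZ cardY by linarith
qed

section \<open>A linear orthomorphism of F_2^\<alpha>\<close>

text \<open>Multiplication by the companion matrix of \<open>X^\<alpha> + X + 1\<close>. As 0 and 1 are not roots of this
  polynomial, \<open>g \<mapsto> \<phi> g\<close> and \<open>g \<mapsto> g + \<phi> g\<close> are both bijective.\<close>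

definition comp_map :: "nat \<Rightarrow> nat \<Rightarrow> nat" where
  "comp_map \<alpha> g = take_bit \<alpha> (2 * g XOR (if bit g (\<alpha> - 1) then 3 else 0))"

text \<open>The constant 3 encodes X + 1, the remainder of X^\<alpha>, so the top bit feeds bits 0
  and 1.\<close>

lemma bit_comp_map:
  "bit (comp_map \<alpha> g) i \<longleftrightarrow>
     i < \<alpha> \<and> ((0 < i \<and> bit g (i - 1)) \<noteq> (bit g (\<alpha> - 1) \<and> i < 2))"
  by (cases i) (auto simp: comp_map_def bit_take_bit_iff bit_xor_iff bit_double_iff bit_Suc_0_iff)

lemma xor_less_power: "g < 2 ^ \<alpha> \<Longrightarrow> h < 2 ^ \<alpha> \<Longrightarrow> g XOR h < (2 :: nat) ^ \<alpha>"
  by (metis take_bit_nat_eq_self_iff take_bit_xor)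

lemma comp_map_less: "comp_map \<alpha> g < 2 ^ \<alpha>"
  unfolding comp_map_def by (rule take_bit_nat_less_exp)

lemma not_bit_of_less: "g < (2::nat) ^ \<alpha> \<Longrightarrow> \<alpha> \<le> i \<Longrightarrow> \<not> bit g i"
  by (metis bit_take_bit_iff leD take_bit_nat_eq_self)

text \<open>Bit 0 of the image is the top bit of \<open>g\<close>; once that is known, bit
  \<open>i + 1\<close> of the image yields bit \<open>i\<close> of \<open>g\<close>.\<close>

lemma inj_on_comp_map:
  assumes "2 \<le> \<alpha>"
  shows "inj_on (comp_map \<alpha>) {..<2 ^ \<alpha>}"
proof (rule inj_onI)
  fix g h :: nat
  assume g: "g \<in> {..<2 ^ \<alpha>}" and h: "h \<in> {..<2 ^ \<alpha>}" and eq: "comp_map \<alpha> g = comp_map \<alpha> h"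
  have *: "bit (comp_map \<alpha> g) i = bit (comp_map \<alpha> h) i" for i
    using eq by simp
  have top: "bit g (\<alpha> - 1) = bit h (\<alpha> - 1)"
    using *[of 0] assms by (auto simp: bit_comp_map)
  show "g = h"
  proof (rule bit_eqI)
    fix i
    show "bit g i = bit h i"
    proof (cases "Suc i < \<alpha>")
      case True
      then show ?thesis
        using *[of "Suc i"] top by (auto simp: bit_comp_map)
    next
      case False
      then have "i = \<alpha> - 1 \<or> \<alpha> \<le> i"
        by linarith
      then show ?thesis
        using top g h by (auto simp: not_bit_of_less)
    qed
  qed
qed

text \<open>The bitwise difference \<open>z\<close> of \<open>g\<close> and \<open>h\<close> is a
  fixed vector of the linear map. Bit 0 gives \<open>z 0 = z (\<alpha> - 1)\<close>, so the two
  contributions to bit 1 cancel; the zero then propagates up to the top bit, and from there back to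
  bit 0.\<close>

lemma inj_on_xor_comp_map:
  assumes "2 \<le> \<alpha>"
  shows "inj_on (\<lambda>g. g XOR comp_map \<alpha> g) {..<2 ^ \<alpha>}"
proof (rule inj_onI)
  fix g h :: nat
  assume g: "g \<in> {..<2 ^ \<alpha>}" and h: "h \<in> {..<2 ^ \<alpha>}"
    and eq: "g XOR comp_map \<alpha> g = h XOR comp_map \<alpha> h"
  define z where "z i \<longleftrightarrow> bit g i \<noteq> bit h i" for i
  have *: "z i \<longleftrightarrow> (0 < i \<and> z (i - 1)) \<noteq> (z (\<alpha> - 1) \<and> i < 2)" if "i < \<alpha>" for i
    using arg_cong[OF eq, of "\<lambda>n. bit n i"] that by (auto simp: bit_comp_map bit_xor_iff z_def)
  have bottom: "z 0 \<longleftrightarrow> z (\<alpha> - 1)"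
    using *[of 0] assms by simp
  have high: "i < \<alpha> \<longrightarrow> \<not> z i" if "1 \<le> i" for i
    using that
  proof (induction i rule: dec_induct)
    case base
    show ?case
      using *[of 1] bottom by simp
  next
    case (step i)
    then show ?case
      using *[of "Suc i"] by simp
  qed
  have "\<not> z i" if "i < \<alpha>" for i
  proof (cases "i = 0")
    case True
    have "1 \<le> \<alpha> - 1" "\<alpha> - 1 < \<alpha>"
      using assms by auto
    then show ?thesis
      using high bottom True by blast
  next
    case False
    then show ?thesis
      using high[of i] that by simp
  qed
  moreover have "\<not> z i" if "\<alpha> \<le> i" for i
    using g h that by (auto simp: z_def not_bit_of_less)
  ultimately have "\<not> z i" for i
    by (meson not_le)
  then show "g = h"
    by (intro bit_eqI) (auto simp: z_def)
qed

section \<open>The signed Latin square and its interchangeable rows\<close>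

text \<open>The exponent of the row sign is the nondegenerate alternating form \<open>B\<close> on \<open>F_2^2\<close>, that of
  the column sign is the indicator \<open>T\<close> of the nonzero vectors. They are related by
  \<open>T a + T (a + d) = 1 + B(a, d)\<close> for \<open>d \<noteq> 0\<close>.\<close>

definition sgn_row :: "nat \<Rightarrow> nat \<Rightarrow> int" where
  "sgn_row g h = (if (bit g 0 \<and> bit h 1) \<noteq> (bit g 1 \<and> bit h 0) then - 1 else 1)"

definition sgn_col :: "nat \<Rightarrow> int" where
  "sgn_col g = (if bit g 0 \<or> bit g 1 then - 1 else 1)"

definition sgn_op :: "nat \<Rightarrow> nat \<times> int \<Rightarrow> nat \<times> int \<Rightarrow> nat \<times> int" where
  "sgn_op m = (\<lambda>(g, x) (h, y). (g XOR h, (sgn_row g h * x + sgn_col g * y) mod int m))"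

lemma mod_4_eq_iff_bit:
  fixes g h :: nat
  shows "g mod 4 = h mod 4 \<longleftrightarrow> bit g 0 = bit h 0 \<and> bit g 1 = bit h 1"
proof -
  have "g mod 4 = h mod 4 \<longleftrightarrow> take_bit 2 g = take_bit 2 h"
    by (simp add: take_bit_eq_mod)
  also have "\<dots> \<longleftrightarrow> (\<forall>i<2. bit g i = bit h i)"
    by (auto simp: bit_eq_iff bit_take_bit_iff)
  also have "\<dots> \<longleftrightarrow> bit g 0 = bit h 0 \<and> bit g 1 = bit h 1"
    by (auto simp: less_2_cases_iff simp del: bit_0)
  finally show ?thesis .
qed

lemma sgn_row_cases: "sgn_row g h = 1 \<or> sgn_row g h = - 1"
  by (simp add: sgn_row_def)

lemma sgn_col_cases: "sgn_col g = 1 \<or> sgn_col g = - 1"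
  by (simp add: sgn_col_def)

lemma mod_eq_imp_eq:
  fixes x y k :: int
  assumes "k dvd x - y" "0 \<le> x" "x < k" "0 \<le> y" "y < k"
  shows "x = y"
  using assms by (metis mod_eq_dvd_iff mod_pos_pos_trivial)

lemma sgn_mod_cancel:
  fixes s x y z :: int
  assumes "s = 1 \<or> s = - 1" "(z + s * x) mod k = (z + s * y) mod k" "0 \<le> x" "x < k" "0 \<le> y" "y < k"
  shows "x = y"
proof (rule mod_eq_imp_eq)
  have "k dvd s * (x - y)"
    using assms(2) by (simp add: mod_eq_dvd_iff algebra_simps)
  then show "k dvd x - y"
    using assms(1) by (metis dvd_minus_iff mult_1 mult_minus1)
qed (use assms in auto)

lemma latin_op_sgn_op:
  assumes "0 < m"
  shows "latin_op ({..<2 ^ \<alpha>} \<times> {0..<int m}) (sgn_op m)"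
proof (rule latin_opI)
  let ?A = "{..<(2 :: nat) ^ \<alpha>} \<times> {0..<int m}"
  show "finite ?A"
    by simp
  show "sgn_op m r c \<in> ?A" if "r \<in> ?A" "c \<in> ?A" for r c
    using that assms by (auto simp: sgn_op_def xor_less_power)
  show "c = c'" if c: "c \<in> ?A" "c' \<in> ?A" and eq: "sgn_op m r c = sgn_op m r c'" for r c c'
  proof -
    obtain g x h y h' y' where [simp]: "r = (g, x)" "c = (h, y)" "c' = (h', y')"
      by (metis surj_pair)
    have "h = h'"
      using eq by (auto simp: sgn_op_def) (metis xor.left_commute xor_self_eq xor.right_neutral)
    then show "c = c'"
      using eq c sgn_mod_cancel[OF sgn_col_cases, of "sgn_row g h * x" g y "int m" y']
      by (auto simp: sgn_op_def)
  qed
  show "r = r'" if r: "r \<in> ?A" "r' \<in> ?A" and eq: "sgn_op m r c = sgn_op m r' c" for r r' c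
  proof -
    obtain g x h y g' x' where [simp]: "r = (g, x)" "c = (h, y)" "r' = (g', x')"
      by (metis surj_pair)
    have "g = g'"
      using eq by (auto simp: sgn_op_def) (metis xor.assoc xor_self_eq xor.right_neutral)
    then show "r = r'"
      using eq r sgn_mod_cancel[OF sgn_row_cases, of "sgn_col g * y" g h x "int m" x']
      by (auto simp: sgn_op_def add.commute)
  qed
qed

lemma mod_add_mult_mod: "(a + t * (b mod k)) mod k = (a + t * b) mod (k :: int)"
  by (metis mod_add_right_eq mod_mult_right_eq)

lemma sgn_col_square_mult: "sgn_col g * (sgn_col g * x) = x"
  by (simp add: sgn_col_def)

text \<open>Shifting \<open>h\<close> by \<open>d = g + g'\<close> changes either row sign by the
  factor (-1)^B(g, g'), as B is alternating. The relation between T and B turns this factor into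
  \<open>- sgn_col g * sgn_col g'\<close>.\<close>

lemma sgn_row_xor:
  assumes "g mod 4 \<noteq> g' mod 4"
  shows "sgn_row g (h XOR (g XOR g')) = - sgn_col g * sgn_col g' * sgn_row g h"
    and "sgn_row g' h = - sgn_col g * sgn_col g' * sgn_row g' (h XOR (g XOR g'))"
  using assms unfolding mod_4_eq_iff_bit sgn_row_def sgn_col_def bit_xor_iff
  by (auto simp del: bit_0)

lemma sgn_row_xor_same:
  assumes "g mod 4 = g' mod 4"
  shows "sgn_row g' (h XOR (g XOR g')) = sgn_row g h" "sgn_row g (h XOR (g XOR g')) = sgn_row g' h"
  using assms unfolding mod_4_eq_iff_bit sgn_row_def bit_xor_iff
  by (auto simp del: bit_0)

lemma sgn_col_cong: "g mod 4 = g' mod 4 \<Longrightarrow> sgn_col g = sgn_col g'"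
  unfolding mod_4_eq_iff_bit sgn_col_def by simp

lemma sgn_op_swap:
  assumes m: "0 < m" and g: "g < 2 ^ \<alpha>" "g' < 2 ^ \<alpha>" and h: "h < 2 ^ \<alpha>" "y \<in> {0..<int m}"
    and rows: "g mod 4 \<noteq> g' mod 4 \<or> x = x'"
  shows "\<exists>c\<in>{..<2 ^ \<alpha>} \<times> {0..<int m}. sgn_op m (g, x) (h, y) = sgn_op m (g', x') c \<and>
    sgn_op m (g, x) c = sgn_op m (g', x') (h, y)"
proof -
  \<comment> \<open>The XOR parts of both symbol equations force this first coordinate of the
    partner column.\<close>
  define h' where "h' = h XOR (g XOR g')"
  have h': "h' < 2 ^ \<alpha>"
    using g h by (simp add: h'_def xor_less_power)
  have xor: "g' XOR h' = g XOR h" "g XOR h' = g' XOR h"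
    by (simp_all add: h'_def bit_eq_iff bit_xor_iff) blast+
  show ?thesis
  proof (cases "g mod 4 = g' mod 4")
    \<comment> \<open>All signs agree across the two rows and \<open>x = x'\<close>, so the second
      coordinate \<open>y\<close> can be kept.\<close>
    case True
    then show ?thesis
      using rows h h' sgn_row_xor_same[OF True, of h, folded h'_def] sgn_col_cong[OF True]
      by (intro bexI[of _ "(h', y)"]) (auto simp: sgn_op_def xor)
  next
    case False
    let ?s = "sgn_row g h" and ?t = "sgn_col g" and ?s' = "sgn_row g' h'" and ?t' = "sgn_col g'"
    \<comment> \<open>Solution of the first symbol equation, as \<open>?t'\<close> is its own
      inverse; the sign relations \<open>sgn\<close> make it solve the second one too.\<close>
    define z where "z = ?t' * (?s * x + ?t * y - ?s' * x')"
    note sgn = sgn_row_xor[OF False, of h, folded h'_def]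
    have "?s' * x' + ?t' * z = ?s * x + ?t * y"
      by (simp add: z_def sgn_col_square_mult)
    moreover have "sgn_row g h' * x + ?t * z = sgn_row g' h * x' + ?t' * y"
      unfolding sgn z_def by (auto simp: sgn_col_def algebra_simps)
    ultimately show ?thesis
      using m h' by (intro bexI[of _ "(h', z mod int m)"]) (auto simp: sgn_op_def xor mod_add_mult_mod)
  qed
qed

section \<open>The transversal of the signed square\<close>

text \<open>The column sign is built in so that it cancels in \<open>sgn_op\<close>, leaving the
  same row sign on both summands of the symbol.\<close>

definition sgn_transversal :: "nat \<Rightarrow> nat \<Rightarrow> nat \<times> int \<Rightarrow> nat \<times> int" where
  "sgn_transversal \<alpha> m = (\<lambda>(g, x).
     (comp_map \<alpha> g, (sgn_row g (comp_map \<alpha> g) * sgn_col g * x) mod int m))"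

lemma bij_betw_sgn_transversal:
  assumes "2 \<le> \<alpha>" "0 < m"
  shows "bij_betw (sgn_transversal \<alpha> m) ({..<2 ^ \<alpha>} \<times> {0..<int m}) ({..<2 ^ \<alpha>} \<times> {0..<int m})"
proof -
  let ?A = "{..<(2 :: nat) ^ \<alpha>} \<times> {0..<int m}"
  have inj: "inj_on (sgn_transversal \<alpha> m) ?A"
  proof (rule inj_onI)
    fix r r'
    assume r: "r \<in> ?A" "r' \<in> ?A" and eq: "sgn_transversal \<alpha> m r = sgn_transversal \<alpha> m r'"
    obtain g x g' x' where [simp]: "r = (g, x)" "r' = (g', x')"
      by (metis surj_pair)
    have "g = g'"
      using r eq inj_onD[OF inj_on_comp_map[OF assms(1)], of g g'] by (auto simp: sgn_transversal_def)
    moreover have "sgn_row g (comp_map \<alpha> g) * sgn_col g = 1 \<or> sgn_row g (comp_map \<alpha> g) * sgn_col g = - 1"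
      using sgn_row_cases[of g "comp_map \<alpha> g"] sgn_col_cases[of g] by auto
    ultimately show "r = r'"
      using r eq sgn_mod_cancel[of "sgn_row g (comp_map \<alpha> g) * sgn_col g" 0 x "int m" x']
      by (auto simp: sgn_transversal_def)
  qed
  moreover have "sgn_transversal \<alpha> m ` ?A \<subseteq> ?A"
    using assms by (auto simp: sgn_transversal_def comp_map_less)
  ultimately have "sgn_transversal \<alpha> m ` ?A = ?A"
    by (intro endo_inj_surj) auto
  with inj show ?thesis
    by (simp add: bij_betw_def)
qed

text \<open>Taking \<open>x' = x\<close> gives the symbols of the transversal; the symmetry in
  \<open>x\<close> and \<open>x'\<close> gives the pairs of cells that share an intercalate after
  prolongation.\<close>

lemma sgn_op_transversal:
  "sgn_op m (g, x) (sgn_transversal \<alpha> m (g, x')) =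
     (g XOR comp_map \<alpha> g, (sgn_row g (comp_map \<alpha> g) * (x + x')) mod int m)"
  by (simp add: sgn_op_def sgn_transversal_def mod_add_mult_mod mult.assoc mult.left_commute
      sgn_col_square_mult distrib_left)

lemma inj_on_sgn_transversal_symbol:
  assumes "2 \<le> \<alpha>" "odd m"
  shows "inj_on (\<lambda>r. sgn_op m r (sgn_transversal \<alpha> m r)) ({..<2 ^ \<alpha>} \<times> {0..<int m})"
proof (rule inj_onI)
  let ?A = "{..<(2 :: nat) ^ \<alpha>} \<times> {0..<int m}"
  fix r r'
  assume r: "r \<in> ?A" "r' \<in> ?A"
    and eq: "sgn_op m r (sgn_transversal \<alpha> m r) = sgn_op m r' (sgn_transversal \<alpha> m r')"
  obtain g x g' x' where rr [simp]: "r = (g, x)" "r' = (g', x')"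
    by (metis surj_pair)
  have g: "g = g'"
    using r eq inj_onD[OF inj_on_xor_comp_map[OF assms(1)], of g g'] by (auto simp: sgn_op_transversal)
  let ?s = "sgn_row g (comp_map \<alpha> g)"
  have "int m dvd ?s * (x + x) - ?s * (x' + x')"
    using eq g by (simp add: sgn_op_transversal mod_eq_dvd_iff)
  then have "int m dvd 2 * (x - x')"
    using sgn_row_cases[of g "comp_map \<alpha> g"] by (auto simp: algebra_simps dvd_diff_commute)
  moreover have "coprime (int m) 2"
    using assms(2) by simp
  ultimately have "int m dvd x - x'"
    using coprime_dvd_mult_right_iff by blast
  then show "r = r'"
    using r g mod_eq_imp_eq[of "int m" x x'] by auto
qed

section \<open>Counting partner rows\<close>

lemma card_mod_eq:
  fixes k p n :: nat
  assumes "k < n"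
  shows "card {i \<in> {..<n * p}. i mod n = k} = p"
proof -
  have "{i \<in> {..<n * p}. i mod n = k} = (\<lambda>j. n * j + k) ` {..<p}"
  proof (intro set_eqI iffI)
    fix i
    assume i: "i \<in> {i \<in> {..<n * p}. i mod n = k}"
    then have "i = n * (i div n) + k"
      by (metis (lifting) mem_Collect_eq mult_div_mod_eq)
    moreover have "i div n < p"
      using i by (simp add: less_mult_imp_div_less mult.commute)
    ultimately show "i \<in> (\<lambda>j. n * j + k) ` {..<p}"
      by blast
  next
    fix i
    assume "i \<in> (\<lambda>j. n * j + k) ` {..<p}"
    then obtain j where j: "j < p" "i = n * j + k"
      by auto
    have "n * j + k < n * Suc j"
      using assms by simp
    also have "\<dots> \<le> n * p"
      using j(1) by (intro mult_le_mono2) simp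
    finally show "i \<in> {i \<in> {..<n * p}. i mod n = k}"
      using assms j(2) by simp
  qed
  moreover have "inj_on (\<lambda>j. n * j + k) {..<p}"
    using assms by (simp add: inj_on_def)
  ultimately show ?thesis
    by (simp add: card_image)
qed

text \<open>The rows other than \<open>(g, x)\<close> that satisfy the condition \<open>rows\<close>
  of \<open>sgn_op_swap\<close>.\<close>

definition swap_rows :: "nat \<Rightarrow> nat \<Rightarrow> nat \<times> int \<Rightarrow> (nat \<times> int) set" where
  "swap_rows n m = (\<lambda>(g, x). {g' \<in> {..<n}. g' mod 4 \<noteq> g mod 4} \<times> {0..<int m} \<union>
     ({g' \<in> {..<n}. g' mod 4 = g mod 4} - {g}) \<times> {x})"

text \<open>Three residue classes mod 4 contribute \<open>p * m\<close> rows each; the class of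
  \<open>g\<close> contributes \<open>p - 1\<close> rows with the same \<open>x\<close>.\<close>

lemma card_swap_rows:
  assumes "g < 4 * p"
  shows "card (swap_rows (4 * p) m (g, x)) = 3 * p * m + (p - 1)"
proof -
  let ?S = "{g' \<in> {..<4 * p}. g' mod 4 = g mod 4}"
  have S: "card ?S = p"
    by (rule card_mod_eq) simp
  have "{g' \<in> {..<4 * p}. g' mod 4 \<noteq> g mod 4} = {..<4 * p} - ?S"
    by auto
  then have "card {g' \<in> {..<4 * p}. g' mod 4 \<noteq> g mod 4} = card {..<4 * p} - card ?S"
    by (simp only:) (rule card_Diff_subset, auto)
  then have "card {g' \<in> {..<4 * p}. g' mod 4 \<noteq> g mod 4} = 3 * p"
    using S by simp
  moreover have "card (?S - {g}) = p - 1"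
    using S assms by (subst card_Diff_singleton) auto
  ultimately show ?thesis
    unfolding swap_rows_def prod.case
    by (subst card_Un_disjoint) (auto simp: card_cartesian_product)
qed

lemma card_off_diagonal:
  assumes "finite X"
  shows "card (SIGMA x:X. X - {x}) = card X * (card X - 1)"
  using assms by (simp add: card_SigmaI)

section \<open>Assembling the bound\<close>

lemma max_intercalates_ge:
  fixes k m :: nat
  defines "p \<equiv> 2 ^ k"
  assumes "odd m"
  shows "4 * p * m * (3 * p * m + (p - 1)) * (4 * p * m - 4) + 4 * (4 * p * m) + 2 * (4 * p * (m * (m - 1)))
    \<le> 4 * max_intercalates (4 * p * m + 1)"
proof -
  define \<alpha> where "\<alpha> = k + 2"
  have \<alpha>: "2 \<le> \<alpha>" "(2 :: nat) ^ \<alpha> = 4 * p"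
    by (simp_all add: \<alpha>_def p_def)
  have m: "0 < m"
    using assms(2) by (rule odd_pos)
  let ?A = "{..<4 * p} \<times> {0..<int m}"
  let ?f = "sgn_op m" and ?\<theta> = "sgn_transversal \<alpha> m"
  \<comment> \<open>Ordered pairs of distinct rows with the same \<open>g\<close>; the symmetry in
    \<open>sgn_op_transversal\<close> applies to them.\<close>
  define P where "P = (\<lambda>(g, x, x'). ((g, x), (g, x'))) `
    ({..<4 * p} \<times> (SIGMA x:{0..<int m}. {0..<int m} - {x}))"
  have cardP: "card P = 4 * p * (m * (m - 1))"
    unfolding P_def by (subst card_image) (auto simp: inj_on_def card_cartesian_product card_off_diagonal)
  have "card ?A * (3 * p * m + (p - 1)) * (card ?A - 4) + 4 * card ?A + 2 * card P
    \<le> 4 * max_intercalates (card ?A + 1)"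
  proof (rule card_prolong_intercalates_ge[where R = "swap_rows (4 * p) m"])
    show "latin_op ?A ?f" "bij_betw ?\<theta> ?A ?A" "inj_on (\<lambda>r. ?f r (?\<theta> r)) ?A"
      using latin_op_sgn_op[OF m, of \<alpha>] bij_betw_sgn_transversal[OF \<alpha>(1) m]
        inj_on_sgn_transversal_symbol[OF \<alpha>(1) assms(2)] by (simp_all only: \<alpha>(2))
    show "swap_rows (4 * p) m r \<subseteq> ?A - {r} \<and> card (swap_rows (4 * p) m r) = 3 * p * m + (p - 1)"
      if "r \<in> ?A" for r
      using that by (cases r) (auto simp: card_swap_rows, auto simp: swap_rows_def)
    show "\<exists>c'\<in>?A. ?f r c = ?f r' c' \<and> ?f r c' = ?f r' c"
      if "r \<in> ?A" "r' \<in> swap_rows (4 * p) m r" "c \<in> ?A" for r r' c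
    proof -
      obtain g x g' x' h y where [simp]: "r = (g, x)" "r' = (g', x')" "c = (h, y)"
        by (metis surj_pair)
      show ?thesis
        using sgn_op_swap[OF m, of g \<alpha> g' h y x x'] that unfolding \<alpha>(2) by (auto simp: swap_rows_def)
    qed
    show "P \<subseteq> {(r, r'). r \<in> ?A \<and> r' \<in> ?A \<and> r \<noteq> r' \<and> ?f r (?\<theta> r') = ?f r' (?\<theta> r)}"
      by (auto simp: P_def sgn_op_transversal add.commute)
  qed
  then show ?thesis
    by (simp add: cardP card_cartesian_product)
qed

theorem theorem5:
  fixes \<alpha> m :: nat
  assumes "\<alpha> = 2 \<or> \<alpha> \<ge> 4" and "odd m"
  shows "real (max_intercalates (2 ^ \<alpha> * m + 1)) \<ge>
           2 ^ \<alpha> * real m *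
             (2 ^ \<alpha> * real m * (3 * real m * 2 ^ \<alpha> + 2 ^ \<alpha> - 20) / 16 + real m + 1)
           + 2 ^ (\<alpha> - 1) * real m * (real m - 1)"
proof -
  define k where "k = \<alpha> - 2"
  have \<alpha>: "\<alpha> = Suc (Suc k)"
    using assms(1) by (auto simp: k_def)
  define p :: nat where "p = 2 ^ k"
  \<comment> \<open>These bounds make the three truncated subtractions in
    \<open>max_intercalates_ge\<close> exact over the reals.\<close>
  have p: "1 \<le> p" and m: "1 \<le> m"
    using odd_pos[OF assms(2)] by (simp_all add: p_def)
  have pm: "4 * p * m \<ge> 4"
    using p m by (metis mult.assoc mult.right_neutral mult_le_mono one_le_mult_iff le_refl)
  have "real (4 * p * m * (3 * p * m + (p - 1)) * (4 * p * m - 4) + 4 * (4 * p * m) + 2 * (4 * p * (m * (m - 1))))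
    \<le> real (4 * max_intercalates (4 * p * m + 1))"
    using max_intercalates_ge[OF assms(2), of k] unfolding p_def by (rule of_nat_mono)
  then have main: "4 * real p * m * (3 * p * m + real p - 1) * (4 * real p * m - 4) + 4 * (4 * p * m)
      + 2 * (4 * p * (m * (real m - 1))) \<le> 4 * real (max_intercalates (4 * p * m + 1))"
    using p m pm by (simp add: of_nat_diff)
  \<comment> \<open>This product is exactly the left side of \<open>main\<close> minus four times
    the claimed bound.\<close>
  have "0 \<le> 16 * real p * m * (real m - 1) * (real p - 1)"
    using p m by (intro mult_nonneg_nonneg) auto
  moreover have pow: "2 ^ \<alpha> = 4 * real p" "2 ^ (\<alpha> - 1) = 2 * real p" "2 ^ \<alpha> = 4 * p"
    by (simp_all add: \<alpha> p_def)
  ultimately show ?thesis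
    using main unfolding pow by (simp add: field_simps power2_eq_square)
qed

end
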